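(* There exists a computable coloring $C:[\mathbb{N}]^{!\omega}\to 2$ such that no infinite homogeneous set for $C$ is $\Sigma^0_i$, for any $i\in\mathbb{N}$.
   Context: A finite set $X\subseteq\mathbb{N}$ is exactly large if $|X|=\min(X)+1$; $[X]^{!\omega}$ is the set of exactly large subsets of $X$. A set $H$ is homogeneous for $C$ if $C$ is constant on $[H]^{!\omega}$. *)

theory Defs
  imports Main "HOL-Library.FuncSet" "HOL-Library.Nat_Bijection"
begin

section \<open>Total recursive functions\<close>

text \<open>
  \<open>recursive_fn n f\<close>: the restriction of \<open>f\<close> to lists of length \<open>n\<close> is a total recursive
  (equivalently, total computable) \<open>n\<close>-ary function. Minimization is applied to regular
  functions only, so every function generated is total. The rule \<open>ext\<close> makes the values of
  \<open>f\<close> on lists of any other length irrelevant.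
\<close>

inductive recursive_fn :: "nat \<Rightarrow> (nat list \<Rightarrow> nat) \<Rightarrow> bool" where
  zero: "recursive_fn n (\<lambda>xs. 0)"
| succ: "recursive_fn 1 (\<lambda>xs. Suc (xs ! 0))"
| proj: "i < n \<Longrightarrow> recursive_fn n (\<lambda>xs. xs ! i)"
| comp: "recursive_fn (length gs) f \<Longrightarrow> (\<forall>g\<in>set gs. recursive_fn n g) \<Longrightarrow>
    recursive_fn n (\<lambda>xs. f (map (\<lambda>g. g xs) gs))"
| prim_rec: "recursive_fn n f \<Longrightarrow> recursive_fn (Suc (Suc n)) g \<Longrightarrow>
    recursive_fn (Suc n) (\<lambda>xs. rec_nat (f (tl xs)) (\<lambda>y r. g (y # r # tl xs)) (hd xs))"
| minim: "recursive_fn (Suc n) f \<Longrightarrow> (\<forall>xs. length xs = n \<longrightarrow> (\<exists>y. f (y # xs) = 0)) \<Longrightarrow>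
    recursive_fn n (\<lambda>xs. LEAST y. f (y # xs) = 0)"
| ext: "recursive_fn n f \<Longrightarrow> (\<forall>xs. length xs = n \<longrightarrow> g xs = f xs) \<Longrightarrow> recursive_fn n g"

definition recursive_rel :: "nat \<Rightarrow> (nat list \<Rightarrow> bool) \<Rightarrow> bool" where
  "recursive_rel n R \<longleftrightarrow> recursive_fn n (\<lambda>xs. if R xs then 1 else 0)"

section \<open>The arithmetical hierarchy\<close>

text \<open>
  \<open>sigma_rel i n R\<close> and \<open>pi_rel i n R\<close>: the \<open>n\<close>-ary relation \<open>R\<close> is defined by a prefix of \<open>i\<close>
  alternating number quantifiers, the outermost one existential respectively universal, in
  front of a recursive relation. Level \<open>0\<close> consists of the recursive relations.
\<close>

fun sigma_rel :: "nat \<Rightarrow> nat \<Rightarrow> (nat list \<Rightarrow> bool) \<Rightarrow> bool"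
  and pi_rel :: "nat \<Rightarrow> nat \<Rightarrow> (nat list \<Rightarrow> bool) \<Rightarrow> bool" where
  "sigma_rel 0 n R \<longleftrightarrow> recursive_rel n R"
| "sigma_rel (Suc i) n R \<longleftrightarrow>
    (\<exists>S. pi_rel i (Suc n) S \<and> (\<forall>xs. length xs = n \<longrightarrow> (R xs \<longleftrightarrow> (\<exists>y. S (y # xs)))))"
| "pi_rel 0 n R \<longleftrightarrow> recursive_rel n R"
| "pi_rel (Suc i) n R \<longleftrightarrow>
    (\<exists>S. sigma_rel i (Suc n) S \<and> (\<forall>xs. length xs = n \<longrightarrow> (R xs \<longleftrightarrow> (\<forall>y. S (y # xs)))))"

definition sigma_set :: "nat \<Rightarrow> nat set \<Rightarrow> bool" where
  "sigma_set i A \<longleftrightarrow> sigma_rel i 1 (\<lambda>xs. xs ! 0 \<in> A)"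

section \<open>Colorings of exactly large sets\<close>

definition exactly_large :: "nat set \<Rightarrow> bool" where
  "exactly_large X \<longleftrightarrow> finite X \<and> X \<noteq> {} \<and> card X = Min X + 1"

definition exactly_large_subsets :: "nat set \<Rightarrow> nat set set" where
  "exactly_large_subsets X = {Y. Y \<subseteq> X \<and> exactly_large Y}"

text \<open>
  A finite set \<open>X\<close> is presented to an algorithm by its canonical index
  \<^term>\<open>set_encode X\<close>, the sum of \<open>2 ^ x\<close> over \<open>x \<in> X\<close>. Since the canonical indices of exactly
  large sets form a decidable set, computability of \<open>C\<close> on these sets is the same as having
  a total recursive extension to all indices.
\<close>

definition computable_coloring :: "(nat set \<Rightarrow> nat) \<Rightarrow> bool" where
  "computable_coloring C \<longleftrightarrow>
    (\<exists>f. recursive_fn 1 f \<and> (\<forall>X \<in> exactly_large_subsets UNIV. C X = f [set_encode X]))"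

definition homogeneous :: "(nat set \<Rightarrow> nat) \<Rightarrow> nat set \<Rightarrow> bool" where
  "homogeneous C H \<longleftrightarrow> (\<exists>c. \<forall>X \<in> exactly_large_subsets H. C X = c)"

end

theory Submission imports Defs "HOL-Library.Infinite_Set" begin

text \<open>
  Let \<open>a\<close> be the minimum of \<open>X\<close>. The colour of \<open>X\<close> records whether the first half and the second
  half of the remaining elements, used as successive bounds for nested quantifiers, give the same
  truth values to all arithmetical formulas with code at most \<open>a div 2\<close> and parameter below \<open>a\<close>.
  By the pigeonhole principle an infinite homogeneous set \<open>H\<close> has the colour that means agreement.
  So the truth value of a formula does not depend on the bounds taken from \<open>H\<close>, and letting the
  bounds grow shows that it is the true one. Hence arithmetical truth is arithmetical in \<open>H\<close>, and
  by Tarski's theorem \<open>H\<close> itself is not arithmetical.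
\<close>

section \<open>Recursive functions of environments\<close>

text \<open>Sets of one fixed size supply a fixed number of bounds, which in this way reach only
  formulas of bounded quantifier depth. An exactly large set with minimum \<open>a\<close> has
  \<open>a\<close> further elements, and \<open>a\<close> is unbounded along \<open>H\<close>, so
  every formula and every parameter are eventually covered. The nesting depth of a formula is at
  most its code; codes up to \<open>a div 2\<close> thus need at most \<open>a div 2\<close> bounds,
  and both halves, of sizes \<open>a div 2\<close> and \<open>a - a div 2\<close>, have that many.
  The definition of truth from \<open>H\<close> is existential: a finite subset of \<open>H\<close>
  serves as a certificate, and checking it is decidable. Hence no levels of the hierarchy have to be
  matched against each other. Membership of a pair in a coded finite set is an atom of the language.
  Histories of recursions can then be quantified over directly, without Goedel's beta
  function.\<close>

definition env_of :: "nat list \<Rightarrow> nat \<Rightarrow> nat" where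
  "env_of xs i = (if i < length xs then xs ! i else 0)"

lemma env_of_Cons: "env_of (x # xs) = case_nat x (env_of xs)"
  by (auto simp: env_of_def fun_eq_iff split: nat.split)

definition computes :: "nat \<Rightarrow> ((nat \<Rightarrow> nat) \<Rightarrow> nat) \<Rightarrow> bool" where
  "computes n F \<longleftrightarrow> (\<forall>e e'. (\<forall>i<n. e i = e' i) \<longrightarrow> F e = F e') \<and>
     recursive_fn n (\<lambda>xs. F (env_of xs))"

text \<open>With the arity hidden, the closure rules compose freely: variables are entries of one
  infinite environment, and weakening is automatic.\<close>

definition rec_fun :: "((nat \<Rightarrow> nat) \<Rightarrow> nat) \<Rightarrow> bool" where
  "rec_fun F \<longleftrightarrow> (\<exists>n. computes n F)"

definition rec_rel :: "((nat \<Rightarrow> nat) \<Rightarrow> bool) \<Rightarrow> bool" where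
  "rec_rel P \<longleftrightarrow> rec_fun (\<lambda>e. if P e then 1 else 0)"

lemma computes_cong: "computes n F \<Longrightarrow> (\<And>i. i < n \<Longrightarrow> e i = e' i) \<Longrightarrow> F e = F e'"
  unfolding computes_def by blast

lemma computes_recursive_fn: "computes n F \<Longrightarrow> recursive_fn n (\<lambda>xs. F (env_of xs))"
  unfolding computes_def by blast

lemma computes_substI:
  assumes F: "computes n F" and G: "\<And>i. i < n \<Longrightarrow> recursive_fn m (g i)"
  shows "recursive_fn m (\<lambda>xs. F (\<lambda>i. g i xs))"
proof -
  have "recursive_fn m (\<lambda>xs. F (env_of (map (\<lambda>h. h xs) (map g [0..<n]))))"
    by (rule recursive_fn.comp) (use F G in \<open>auto simp: computes_def\<close>)
  then show ?thesis
    by (rule recursive_fn.ext) (auto intro!: computes_cong[OF F] simp: env_of_def)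
qed

lemma computes_mono:
  assumes F: "computes n F" and "n \<le> m"
  shows "computes m F"
proof -
  have "recursive_fn m (\<lambda>xs. F (\<lambda>i. xs ! i))"
    by (rule computes_substI[OF F]) (use \<open>n \<le> m\<close> in \<open>auto intro: recursive_fn.proj\<close>)
  then have "recursive_fn m (\<lambda>xs. F (env_of xs))"
    by (rule recursive_fn.ext) (use \<open>n \<le> m\<close> in \<open>auto intro!: computes_cong[OF F] simp: env_of_def\<close>)
  moreover have "F e = F e'" if "\<And>i. i < m \<Longrightarrow> e i = e' i" for e e'
    using that \<open>n \<le> m\<close> by (intro computes_cong[OF F]) auto
  ultimately show ?thesis unfolding computes_def by blast
qed

text \<open>\<open>F\<close> reads only its first \<open>n\<close> entries, so only finitely many of
  the \<open>G i\<close> matter, and the sum of their arities bounds them all.\<close>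

lemma rec_fun_subst:
  assumes "rec_fun F" and "\<And>i. rec_fun (G i)"
  shows "rec_fun (\<lambda>e. F (\<lambda>i. G i e))"
proof -
  obtain n where F: "computes n F" using assms unfolding rec_fun_def by blast
  obtain k where k: "\<And>i. computes (k i) (G i)" using assms unfolding rec_fun_def by metis
  define m where "m = (\<Sum>i<n. k i)"
  have G: "computes m (G i)" if "i < n" for i
    by (rule computes_mono[OF k]) (use that in \<open>auto simp: m_def intro: member_le_sum\<close>)
  have "recursive_fn m (\<lambda>xs. F (\<lambda>i. G i (env_of xs)))"
    by (rule computes_substI[OF F]) (use G in \<open>auto simp: computes_def\<close>)
  moreover have "F (\<lambda>i. G i e) = F (\<lambda>i. G i e')" if "\<And>i. i < m \<Longrightarrow> e i = e' i" for e e'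
    by (intro computes_cong[OF F] computes_cong[OF G] that)
  ultimately show ?thesis unfolding rec_fun_def computes_def by blast
qed

lemma rec_fun_comp1: "rec_fun (\<lambda>e. h (e 0)) \<Longrightarrow> rec_fun A \<Longrightarrow> rec_fun (\<lambda>e. h (A e))"
  by (rule rec_fun_subst[where G = "\<lambda>_. A"])

lemma rec_fun_comp2:
  assumes "rec_fun (\<lambda>e. h (e 0) (e 1))" "rec_fun A" "rec_fun B"
  shows "rec_fun (\<lambda>e. h (A e) (B e))"
  using rec_fun_subst[OF assms(1), of "\<lambda>i. if i = 0 then A else B"] assms(2,3) by simp

lemma rec_fun_comp3:
  assumes "rec_fun (\<lambda>e. h (e 0) (e 1) (e 2))" "rec_fun A" "rec_fun B" "rec_fun C"
  shows "rec_fun (\<lambda>e. h (A e) (B e) (C e))"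
  using rec_fun_subst[OF assms(1), of "\<lambda>i. if i = 0 then A else if i = 1 then B else C"] assms(2-)
  by simp

lemma rec_rel_comp1: "rec_rel (\<lambda>e. P (e 0)) \<Longrightarrow> rec_fun A \<Longrightarrow> rec_rel (\<lambda>e. P (A e))"
  unfolding rec_rel_def by (rule rec_fun_comp1)

lemma rec_rel_comp2:
  "rec_rel (\<lambda>e. P (e 0) (e 1)) \<Longrightarrow> rec_fun A \<Longrightarrow> rec_fun B \<Longrightarrow> rec_rel (\<lambda>e. P (A e) (B e))"
  unfolding rec_rel_def by (rule rec_fun_comp2)

lemma rec_rel_comp3:
  "rec_rel (\<lambda>e. P (e 0) (e 1) (e 2)) \<Longrightarrow> rec_fun A \<Longrightarrow> rec_fun B \<Longrightarrow> rec_fun C \<Longrightarrow>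
    rec_rel (\<lambda>e. P (A e) (B e) (C e))"
  unfolding rec_rel_def by (rule rec_fun_comp3)

lemma rec_fun_var: "rec_fun (\<lambda>e. e i)"
proof -
  have "recursive_fn (Suc i) (\<lambda>xs. env_of xs i)"
    by (rule recursive_fn.ext[OF recursive_fn.proj[of i]]) (auto simp: env_of_def)
  then show ?thesis unfolding rec_fun_def computes_def by blast
qed

lemma rec_fun_Suc: "rec_fun F \<Longrightarrow> rec_fun (\<lambda>e. Suc (F e))"
proof (rule rec_fun_comp1[of Suc])
  have "recursive_fn 1 (\<lambda>xs. Suc (env_of xs 0))"
    by (rule recursive_fn.ext[OF recursive_fn.succ]) (auto simp: env_of_def)
  then show "rec_fun (\<lambda>e. Suc (e 0))"
    unfolding rec_fun_def computes_def by (intro exI[of _ 1]) auto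
qed

lemma rec_fun_const: "rec_fun (\<lambda>e. c)"
proof (induction c)
  case 0
  show ?case unfolding rec_fun_def computes_def by (auto intro: recursive_fn.zero)
qed (rule rec_fun_Suc)

lemma rec_fun_rec_nat:
  assumes N: "rec_fun N" and A: "rec_fun A"
    and G: "rec_fun (\<lambda>e. G (e 0) (e (Suc 0)) (\<lambda>i. e (Suc (Suc i))))" (is "rec_fun ?G")
  shows "rec_fun (\<lambda>e. rec_nat (A e) (\<lambda>y r. G y r e) (N e))"
proof -
  obtain n1 where n1: "computes n1 A" using A unfolding rec_fun_def ..
  obtain n2 where n2: "computes n2 ?G" using G unfolding rec_fun_def ..
  define n where "n = max n1 n2"
  have nA: "computes n A" by (rule computes_mono[OF n1]) (simp add: n_def)
  have nG: "computes (Suc (Suc n)) ?G" by (rule computes_mono[OF n2]) (simp add: n_def)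
  let ?F = "\<lambda>e. rec_nat (A (\<lambda>i. e (Suc i))) (\<lambda>y r. G y r (\<lambda>i. e (Suc i))) (e 0)"
  have "recursive_fn (Suc n)
      (\<lambda>xs. rec_nat (A (env_of (tl xs))) (\<lambda>y r. ?G (env_of (y # r # tl xs))) (hd xs))"
    by (rule recursive_fn.prim_rec[OF nA[THEN computes_recursive_fn] nG[THEN computes_recursive_fn]])
  then have "recursive_fn (Suc n) (\<lambda>xs. ?F (env_of xs))"
    by (rule recursive_fn.ext) (auto simp: env_of_Cons length_Suc_conv)
  moreover have "?F e = ?F e'" if ee: "\<And>i. i < Suc n \<Longrightarrow> e i = e' i" for e e'
  proof -
    have "A (\<lambda>i. e (Suc i)) = A (\<lambda>i. e' (Suc i))"
      by (intro computes_cong[OF nA] ee) auto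
    moreover have "G y r (\<lambda>i. e (Suc i)) = G y r (\<lambda>i. e' (Suc i))" for y r
      using computes_cong[OF nG, of "case_nat y (case_nat r (\<lambda>i. e (Suc i)))"
          "case_nat y (case_nat r (\<lambda>i. e' (Suc i)))"] ee by (simp split: nat.split)
    ultimately show ?thesis using ee[of 0] by simp
  qed
  ultimately have "rec_fun ?F" unfolding rec_fun_def computes_def by blast
  \<comment> \<open>The schema recurses on entry 0. Putting \<open>N\<close> there and
    \<open>e j\<close> at entry \<open>Suc j\<close> restores the original environment for the
    parameters.\<close>
  from rec_fun_subst[OF this, of "\<lambda>i. case i of 0 \<Rightarrow> N | Suc j \<Rightarrow> \<lambda>e. e j"] show ?thesis
    using N rec_fun_var by (simp split: nat.split)
qed

lemma rec_fun_Least_zero: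
  assumes F: "rec_fun (\<lambda>e. F (e 0) (\<lambda>i. e (Suc i)))" (is "rec_fun ?F")
    and ex: "\<And>e. \<exists>y. F y e = 0"
  shows "rec_fun (\<lambda>e. LEAST y. F y e = 0)"
proof -
  obtain n where "computes n ?F" using F unfolding rec_fun_def ..
  then have n: "computes (Suc n) ?F" by (rule computes_mono) simp
  have "recursive_fn n (\<lambda>xs. LEAST y. ?F (env_of (y # xs)) = 0)"
    by (rule recursive_fn.minim[OF n[THEN computes_recursive_fn]]) (use ex in \<open>simp add: env_of_Cons\<close>)
  then have "recursive_fn n (\<lambda>xs. LEAST y. F y (env_of xs) = 0)"
    by (rule recursive_fn.ext) (auto simp: env_of_Cons)
  moreover have "(LEAST y. F y e = 0) = (LEAST y. F y e' = 0)"
    if ee: "\<And>i. i < n \<Longrightarrow> e i = e' i" for e e'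
  proof -
    have "F y e = F y e'" for y
      using computes_cong[OF n, of "case_nat y e" "case_nat y e'"] ee by (simp split: nat.split)
    then show ?thesis by simp
  qed
  ultimately show ?thesis unfolding rec_fun_def computes_def by blast
qed

lemma recursive_fn_1_if_rec_fun:
  assumes "rec_fun (\<lambda>e. h (e 0))"
  shows "recursive_fn 1 (\<lambda>xs. h (xs ! 0))"
proof -
  obtain n where "computes n (\<lambda>e. h (e 0))" using assms unfolding rec_fun_def by blast
  from computes_substI[OF this, of 1 "\<lambda>_ xs. xs ! 0"] show ?thesis
    by (auto intro: recursive_fn.proj)
qed

section \<open>Decidable relations and total search\<close>

lemma rec_fun_if:
  assumes "rec_rel P" "rec_fun F" "rec_fun G"
  shows "rec_fun (\<lambda>e. if P e then F e else G e)"
proof -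
  \<comment> \<open>Case distinction is a recursion of length 0 or 1 on the characteristic
    value.\<close>
  have "rec_fun (\<lambda>e. rec_nat (e 2) (\<lambda>_ _. e 1) (e 0))"
    by (intro rec_fun_rec_nat rec_fun_var)
  from rec_fun_comp3[OF this assms(1)[unfolded rec_rel_def] assms(2,3)]
  have "rec_fun (\<lambda>e. rec_nat (G e) (\<lambda>_ _. F e) (if P e then 1 else 0))" by simp
  also have "(\<lambda>e. rec_nat (G e) (\<lambda>_ _. F e) (if P e then 1 else 0)) = (\<lambda>e. if P e then F e else G e)"
    by auto
  finally show ?thesis .
qed

lemma rec_rel_const: "rec_rel (\<lambda>e. b)"
  unfolding rec_rel_def by (rule rec_fun_const)

lemma rec_rel_if:
  assumes "rec_rel P" "rec_rel Q" "rec_rel R"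
  shows "rec_rel (\<lambda>e. if P e then Q e else R e)"
proof -
  have "(\<lambda>e. if (if P e then Q e else R e) then 1 else 0 :: nat) =
      (\<lambda>e. if P e then (if Q e then 1 else 0) else (if R e then 1 else 0))" by auto
  then show ?thesis
    using rec_fun_if[of P, OF assms(1) assms(2,3)[unfolded rec_rel_def]] unfolding rec_rel_def by simp
qed

lemma rec_rel_not:
  assumes "rec_rel P"
  shows "rec_rel (\<lambda>e. \<not> P e)"
  using rec_rel_if[OF assms rec_rel_const[of False] rec_rel_const[of True]]
  by (rule back_subst[of rec_rel]) (auto simp: fun_eq_iff)

lemma rec_rel_conj:
  assumes "rec_rel P" "rec_rel Q"
  shows "rec_rel (\<lambda>e. P e \<and> Q e)"
  using rec_rel_if[OF assms(1) assms(2) rec_rel_const[of False]]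
  by (rule back_subst[of rec_rel]) (auto simp: fun_eq_iff)

lemma rec_rel_disj:
  assumes "rec_rel P" "rec_rel Q"
  shows "rec_rel (\<lambda>e. P e \<or> Q e)"
  using rec_rel_if[OF assms(1) rec_rel_const[of True] assms(2)]
  by (rule back_subst[of rec_rel]) (auto simp: fun_eq_iff)

lemma rec_rel_iff:
  assumes "rec_rel P" "rec_rel Q"
  shows "rec_rel (\<lambda>e. P e \<longleftrightarrow> Q e)"
  using rec_rel_if[OF assms(1) assms(2) rec_rel_not[OF assms(2)]]
  by (rule back_subst[of rec_rel]) (auto simp: fun_eq_iff)

lemma rec_fun_Least:
  assumes "rec_rel (\<lambda>e. P (e 0) (\<lambda>i. e (Suc i)))" and "\<And>e. \<exists>y. P y e"
  shows "rec_fun (\<lambda>e. LEAST y. P y e)"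
proof -
  have "rec_fun (\<lambda>e. LEAST y. (if \<not> P y e then 1 else 0 :: nat) = 0)"
    by (intro rec_fun_Least_zero rec_rel_not[unfolded rec_rel_def] assms(1)[unfolded rec_rel_def])
      (use assms(2) in simp)
  also have "(\<lambda>e. LEAST y. (if \<not> P y e then 1 else 0 :: nat) = 0) = (\<lambda>e. LEAST y. P y e)"
    by (intro HOL.ext arg_cong[of _ _ Least]) auto
  finally show ?thesis .
qed

text \<open>Minimization finds the only \<open>y\<close> with \<open>P y e\<close>. This handles
  halving, the projections of pairs, \<open>lo\<close> and \<open>rest_code\<close>, where a
  decidable graph is easier to give than a recursion.\<close>

lemma rec_fun_graph:
  assumes "rec_rel (\<lambda>e. P (e 0) (\<lambda>i. e (Suc i)))" and P: "\<And>y e. P y e \<longleftrightarrow> y = F e"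
  shows "rec_fun F"
proof -
  have "rec_fun (\<lambda>e. LEAST y. P y e)" using assms by (intro rec_fun_Least) auto
  also have "(\<lambda>e. LEAST y. P y e) = F"
    unfolding P by (intro HOL.ext Least_equality) auto
  finally show ?thesis .
qed

section \<open>Arithmetic, comparison and bounded quantifiers\<close>

lemma rec_fun_plus: "rec_fun A \<Longrightarrow> rec_fun B \<Longrightarrow> rec_fun (\<lambda>e. A e + B e)"
proof (rule rec_fun_comp2[of "(+)"])
  have "rec_fun (\<lambda>e. rec_nat (e 1) (\<lambda>_ r. Suc r) (e 0))"
    by (intro rec_fun_rec_nat rec_fun_Suc rec_fun_var)
  moreover have "rec_nat b (\<lambda>_ r. Suc r) a = a + b" for a b by (induction a) auto
  ultimately show "rec_fun (\<lambda>e. e 0 + e 1)" by simp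
qed

lemma rec_fun_minus: "rec_fun A \<Longrightarrow> rec_fun B \<Longrightarrow> rec_fun (\<lambda>e. A e - B e)"
proof (rule rec_fun_comp2[of "(-)"])
  have "rec_fun (\<lambda>e. rec_nat 0 (\<lambda>y _. y) (e 0))"
    by (intro rec_fun_rec_nat rec_fun_const rec_fun_var)
  moreover have "rec_nat 0 (\<lambda>y _. y) a = a - 1" for a by (cases a) auto
  ultimately have pred: "rec_fun (\<lambda>e. e 0 - 1)" by simp
  have "rec_fun (\<lambda>e. rec_nat (e 0) (\<lambda>_ r. r - 1) (e 1))"
    by (intro rec_fun_rec_nat rec_fun_comp1[OF pred] rec_fun_var)
  moreover have "rec_nat a (\<lambda>_ r. r - 1) b = a - b" for a b by (induction b) auto
  ultimately show "rec_fun (\<lambda>e. e 0 - e 1)" by simp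
qed

lemma rec_rel_less: "rec_fun A \<Longrightarrow> rec_fun B \<Longrightarrow> rec_rel (\<lambda>e. A e < B e)"
proof (rule rec_rel_comp2[of "(<)"])
  have "rec_fun (\<lambda>e. rec_nat 0 (\<lambda>_ _. 1) (e 1 - e 0))"
    by (intro rec_fun_rec_nat rec_fun_minus rec_fun_const rec_fun_var)
  moreover have "(\<lambda>e :: nat \<Rightarrow> nat. rec_nat 0 (\<lambda>_ _. 1) (e 1 - e 0)) = (\<lambda>e. if e 0 < e 1 then 1 else 0 :: nat)"
  proof (rule HOL.ext)
    show "rec_nat 0 (\<lambda>_ _. 1) (e 1 - e 0) = (if e 0 < e 1 then 1 else 0 :: nat)" for e :: "nat \<Rightarrow> nat"
      by (cases "e 1 - e 0") auto
  qed
  ultimately show "rec_rel (\<lambda>e. e 0 < e 1)" unfolding rec_rel_def by simp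
qed

lemma rec_rel_eq: "rec_fun A \<Longrightarrow> rec_fun B \<Longrightarrow> rec_rel (\<lambda>e. A e = B e)"
  using rec_rel_conj[OF rec_rel_not[OF rec_rel_less[of A B]] rec_rel_not[OF rec_rel_less[of B A]]]
  by (simp add: eq_iff not_less conj_commute)

lemma rec_rel_bex:
  assumes B: "rec_fun B" and P: "rec_rel (\<lambda>e. P (e 0) (\<lambda>i. e (Suc i)))"
  shows "rec_rel (\<lambda>e. \<exists>y<B e. P y e)"
proof -
  \<comment> \<open>The disjunct \<open>y = B e\<close> makes the search total; it stops earlier
    exactly if there is a witness.\<close>
  have "rec_rel (\<lambda>e. (LEAST y. P y e \<or> y = B e) < B e)"
    by (intro rec_rel_less rec_fun_Least rec_rel_disj P rec_rel_eq B rec_fun_var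
        rec_fun_subst[OF B]) auto
  moreover have "(LEAST y. P y e \<or> y = B e) < B e \<longleftrightarrow> (\<exists>y<B e. P y e)" for e
  proof
    assume "(LEAST y. P y e \<or> y = B e) < B e"
    then show "\<exists>y<B e. P y e"
      using LeastI[of "\<lambda>y. P y e \<or> y = B e" "B e"] by auto
  next
    assume "\<exists>y<B e. P y e"
    then show "(LEAST y. P y e \<or> y = B e) < B e"
      by (metis (mono_tags, lifting) Least_le le_less_trans)
  qed
  ultimately show ?thesis by simp
qed

lemma rec_rel_ball:
  assumes B: "rec_fun B" and P: "rec_rel (\<lambda>e. P (e 0) (\<lambda>i. e (Suc i)))"
  shows "rec_rel (\<lambda>e. \<forall>y<B e. P y e)"
  using rec_rel_not[OF rec_rel_bex[OF B rec_rel_not[OF P]]] by simp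

lemma rec_fun_funpow:
  assumes h: "rec_fun (\<lambda>e. h (e 0))" and "rec_fun N" "rec_fun A"
  shows "rec_fun (\<lambda>e. (h ^^ N e) (A e))"
proof -
  have "rec_fun (\<lambda>e. rec_nat (A e) (\<lambda>_ r. h r) (N e))"
    by (intro rec_fun_rec_nat assms rec_fun_comp1[OF h] rec_fun_var)
  moreover have "rec_nat a (\<lambda>_ r. h r) n = (h ^^ n) a" for a n by (induction n) auto
  ultimately show ?thesis by simp
qed

section \<open>Codes of finite sets and of pairs\<close>

lemma rec_fun_half: "rec_fun A \<Longrightarrow> rec_fun (\<lambda>e. A e div 2)"
proof (rule rec_fun_comp1[of "\<lambda>x. x div 2"])
  have "rec_rel (\<lambda>e. e 1 = e 0 + e 0 \<or> e 1 = Suc (e 0 + e 0))"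
    by (intro rec_rel_disj rec_rel_eq rec_fun_plus rec_fun_Suc rec_fun_var)
  then show "rec_fun (\<lambda>e. e 0 div 2)"
    by (intro rec_fun_graph[where P = "\<lambda>y e. e 0 = y + y \<or> e 0 = Suc (y + y)"]) (simp, presburger)
qed

lemma mem_set_decode_iff: "i \<in> set_decode z \<longleftrightarrow> odd (((\<lambda>x. x div 2) ^^ i) z)"
  by (induction i arbitrary: z) (simp_all add: funpow_Suc_right del: funpow.simps)

lemma rec_rel_mem: "rec_fun A \<Longrightarrow> rec_fun B \<Longrightarrow> rec_rel (\<lambda>e. A e \<in> set_decode (B e))"
proof (rule rec_rel_comp2[of "\<lambda>i z. i \<in> set_decode z"])
  have "rec_rel (\<lambda>e. e 0 \<noteq> e 0 div 2 + e 0 div 2)"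
    by (intro rec_rel_not rec_rel_eq rec_fun_plus rec_fun_half rec_fun_var)
  moreover have "x \<noteq> x div 2 + x div 2 \<longleftrightarrow> odd x" for x :: nat by presburger
  ultimately have "rec_rel (\<lambda>e. odd (e 0))" by simp
  moreover have "rec_fun (\<lambda>e. ((\<lambda>x. x div 2) ^^ e 0) (e 1))"
    by (intro rec_fun_funpow rec_fun_half rec_fun_var)
  ultimately show "rec_rel (\<lambda>e. e 0 \<in> set_decode (e 1))"
    unfolding mem_set_decode_iff by (rule rec_rel_comp1)
qed

lemma rec_fun_prod_encode: "rec_fun A \<Longrightarrow> rec_fun B \<Longrightarrow> rec_fun (\<lambda>e. prod_encode (A e, B e))"
proof (rule rec_fun_comp2[of "\<lambda>x y. prod_encode (x, y)"])
  have "rec_fun (\<lambda>e. rec_nat 0 (\<lambda>y r. r + Suc y) (e 0))"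
    by (intro rec_fun_rec_nat rec_fun_plus rec_fun_Suc rec_fun_const rec_fun_var)
  moreover have "rec_nat 0 (\<lambda>y r. r + Suc y) n = triangle n" for n by (induction n) auto
  ultimately have tri: "rec_fun (\<lambda>e. triangle (e 0))" by simp
  show "rec_fun (\<lambda>e. prod_encode (e 0, e 1))"
    unfolding prod_encode_def prod.case by (intro rec_fun_plus rec_fun_comp1[OF tri] rec_fun_var)
qed

abbreviation left :: "nat \<Rightarrow> nat" where "left z \<equiv> fst (prod_decode z)"
abbreviation right :: "nat \<Rightarrow> nat" where "right z \<equiv> snd (prod_decode z)"

lemma left_le: "left z \<le> z" and right_le: "right z \<le> z"
  using le_prod_encode_1[of "left z" "right z"] le_prod_encode_2[of "right z" "left z"] by simp_all

text \<open>As \<open>triangle n\<close> is at least \<open>n\<close>, the code \<open>z\<close> is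
  at least \<open>2 * left z + right z\<close>. Every tag except 0, which marks atomic formulas,
  thus makes the codes of subformulas strictly smaller; termination and the bound on the nesting
  depth rest on this.\<close>

lemma right_less:
  assumes "left z \<noteq> 0"
  shows "right z < z"
proof -
  have "n \<le> triangle n" for n by (induction n) auto
  from this[of "left z + right z"] have "right z < prod_encode (left z, right z)"
    using assms unfolding prod_encode_def prod.case by linarith
  then show ?thesis by simp
qed

lemma rec_fun_left: "rec_fun A \<Longrightarrow> rec_fun (\<lambda>e. left (A e))"
proof (rule rec_fun_comp1[of left], rule rec_fun_graph)
  show "rec_rel (\<lambda>e. \<exists>w<Suc (e (Suc 0)). prod_encode (e 0, w) = e (Suc 0))"
    by (intro rec_rel_bex rec_rel_eq rec_fun_prod_encode rec_fun_Suc rec_fun_var)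
  show "(\<exists>w<Suc (e 0). prod_encode (y, w) = e 0) \<longleftrightarrow> y = left (e 0)" for y :: nat and e :: "nat \<Rightarrow> nat"
    using right_le[of "e 0"] by (auto simp: less_Suc_eq_le intro!: exI[of _ "right (e 0)"])
      (metis fst_conv prod_encode_inverse)
qed

lemma rec_fun_right: "rec_fun A \<Longrightarrow> rec_fun (\<lambda>e. right (A e))"
proof (rule rec_fun_comp1[of right], rule rec_fun_graph)
  show "rec_rel (\<lambda>e. \<exists>w<Suc (e (Suc 0)). prod_encode (w, e 0) = e (Suc 0))"
    by (intro rec_rel_bex rec_rel_eq rec_fun_prod_encode rec_fun_Suc rec_fun_var)
  show "(\<exists>w<Suc (e 0). prod_encode (w, y) = e 0) \<longleftrightarrow> y = right (e 0)" for y :: nat and e :: "nat \<Rightarrow> nat"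
    using left_le[of "e 0"] by (auto simp: less_Suc_eq_le intro!: exI[of _ "left (e 0)"])
      (metis snd_conv prod_encode_inverse)
qed

section \<open>Formulas and their bounded evaluation\<close>

text \<open>
  Every number codes a formula and every number \<open>p\<close> codes an environment, the eventually zero
  sequence \<open>entry p\<close>. Quantifiers bind the entry with index \<open>0\<close>: the environments that extend
  \<open>p\<close> by one value are exactly the numbers \<open>q\<close> with \<open>right q = p\<close>.
\<close>

definition entry :: "nat \<Rightarrow> nat \<Rightarrow> nat" where
  "entry p i = left ((right ^^ i) p)"

lemma entry_0: "entry p 0 = left p"
  by (simp add: entry_def)

lemma entry_Suc: "entry p (Suc i) = entry (right p) i"
  by (simp add: entry_def funpow_Suc_right del: funpow.simps)

text \<open>The empty set codes no pair, so the case \<open>w = 0\<close> is free to carry the order relation.\<close>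

definition atom :: "nat \<Rightarrow> nat \<Rightarrow> nat \<Rightarrow> bool" where
  "atom x y w \<longleftrightarrow> (if w = 0 then y < x else prod_encode (x, y) \<in> set_decode w)"

text \<open>The number \<open>t\<close> codes the indices of three variables. There are no constants
  or function symbols; zero and successor are defined from the atoms later.\<close>

definition atomic :: "nat \<Rightarrow> nat \<Rightarrow> bool" where
  "atomic t p \<longleftrightarrow> atom (entry p (left t)) (entry p (left (right t))) (entry p (right (right t)))"

text \<open>Tag 1 is the Sheffer stroke, and all tags from 2 on are the existential quantifier, so
  that no number is ill-formed.\<close>

function sat :: "nat \<Rightarrow> nat \<Rightarrow> bool" where
  "sat c p \<longleftrightarrow>
    (if left c = 0 then atomic (right c) p
     else if left c = 1 then \<not> (sat (left (right c)) p \<and> sat (right (right c)) p)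
     else \<exists>q. right q = p \<and> sat (right c) q)"
  by pat_completeness auto
termination
  by (relation "measure fst")
    (auto intro: le_less_trans[OF left_le right_less] le_less_trans[OF right_le right_less] right_less)

declare sat.simps [simp del]

text \<open>\<open>LEAST\<close> also serves infinite sets. The value 0 at the empty set makes
  \<open>ev\<close> reject every existential formula once the bounds are used up.\<close>

definition lo :: "nat set \<Rightarrow> nat" where
  "lo S = (if S = {} then 0 else LEAST x. x \<in> S)"

definition rest :: "nat set \<Rightarrow> nat set" where
  "rest S = S - {lo S}"

text \<open>
  In \<open>ev c p S\<close> nested quantifiers are bounded by successive elements of \<open>S\<close>. The bound applies
  to the extended environment \<open>q\<close>, not to the value alone, so that \<open>q\<close> is again below the
  elements of \<open>rest S\<close>.
\<close>

function ev :: "nat \<Rightarrow> nat \<Rightarrow> nat set \<Rightarrow> bool" where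
  "ev c p S \<longleftrightarrow>
    (if left c = 0 then atomic (right c) p
     else if left c = 1 then \<not> (ev (left (right c)) p S \<and> ev (right (right c)) p S)
     else \<exists>q<lo S. right q = p \<and> ev (right c) q (rest S))"
  by pat_completeness auto
termination
  by (relation "measure fst")
    (auto intro: le_less_trans[OF left_le right_less] le_less_trans[OF right_le right_less] right_less)

declare ev.simps [simp del]

section \<open>Least elements and end extensions\<close>

lemma lo_in: "S \<noteq> {} \<Longrightarrow> lo S \<in> S"
  unfolding lo_def by (auto intro: LeastI)

lemma lo_le: "x \<in> S \<Longrightarrow> lo S \<le> x"
  unfolding lo_def by (auto intro: Least_le)

lemma lo_eqI: "x \<in> S \<Longrightarrow> (\<And>y. y \<in> S \<Longrightarrow> x \<le> y) \<Longrightarrow> lo S = x"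
  by (metis empty_iff le_antisym lo_in lo_le)

lemma lo_insert: "(\<And>y. y \<in> S \<Longrightarrow> x < y) \<Longrightarrow> lo (insert x S) = x"
  by (rule lo_eqI) (auto intro: less_imp_le)

lemma rest_insert: "(\<And>y. y \<in> S \<Longrightarrow> x < y) \<Longrightarrow> rest (insert x S) = S"
  unfolding rest_def by (auto simp: lo_insert)

lemma lo_less_rest: "x \<in> rest S \<Longrightarrow> lo S < x"
  unfolding rest_def by (metis DiffE lo_le insertI1 le_neq_implies_less)

lemma card_rest: "card (rest S) = card S - 1"
  unfolding rest_def
  by (cases "S = {}") (auto simp: lo_in)

lemma finite_rest: "finite S \<Longrightarrow> finite (rest S)"
  by (simp add: rest_def)

text \<open>Comparing a number with the size of \<open>S\<close> becomes an iteration of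
  \<open>rest\<close>, which is computable on codes.\<close>

lemma funpow_rest_nonempty_iff: "finite S \<Longrightarrow> (rest ^^ n) S \<noteq> {} \<longleftrightarrow> n < card S"
proof (induction n arbitrary: S)
  case (Suc n)
  have "(rest ^^ n) (rest S) \<noteq> {} \<longleftrightarrow> n < card (rest S)"
    by (intro Suc.IH finite_rest Suc.prems)
  then show ?case by (simp add: funpow_Suc_right card_rest less_diff_conv del: funpow.simps)
qed (simp add: card_gt_0_iff)

lemma funpow_rest_Un:
  "finite S \<Longrightarrow> card S = n \<Longrightarrow> (\<And>x y. x \<in> S \<Longrightarrow> y \<in> T \<Longrightarrow> x < y) \<Longrightarrow> (rest ^^ n) (S \<union> T) = T"
proof (induction n arbitrary: S)
  case (Suc n)
  have "lo S \<in> S" using Suc.prems(1,2) by (intro lo_in) auto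
  have "lo (S \<union> T) = lo S"
  proof (rule lo_eqI)
    show "lo S \<le> y" if "y \<in> S \<union> T" for y
      using that lo_le[of y S] Suc.prems(3)[of "lo S" y] \<open>lo S \<in> S\<close> by auto
  qed (use \<open>lo S \<in> S\<close> in simp)
  moreover have "lo S \<notin> T" using Suc.prems(3)[of "lo S" "lo S"] \<open>lo S \<in> S\<close> by auto
  ultimately have "rest (S \<union> T) = rest S \<union> T" by (auto simp: rest_def)
  moreover have "(rest ^^ n) (rest S \<union> T) = T"
  proof (rule Suc.IH)
    show "x < y" if "x \<in> rest S" "y \<in> T" for x y
      using that by (intro Suc.prems(3)) (simp_all add: rest_def)
  qed (use Suc.prems(1,2) in \<open>simp_all add: finite_rest card_rest\<close>)
  ultimately show ?case by (simp add: funpow_Suc_right del: funpow.simps)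
qed simp

text \<open>A formula is not nested more deeply than its code, so \<open>c\<close> bounds suffice to evaluate \<open>c\<close>.\<close>

lemma ev_end_extension:
  assumes "c \<le> card S" "S \<subseteq> S'" "\<And>x y. x \<in> S \<Longrightarrow> y \<in> S' - S \<Longrightarrow> x < y"
  shows "ev c p S \<longleftrightarrow> ev c p S'"
  using assms
proof (induction c arbitrary: p S S' rule: less_induct)
  case (less c)
  consider "left c = 0" | "left c = 1" | "left c \<noteq> 0" "left c \<noteq> 1" by blast
  then show ?case
  proof cases
    case 1
    then show ?thesis by (simp add: ev.simps[of c])
  next
    case 2
    then have "right c < c" by (simp add: right_less)
    then have "left (right c) < c" "right (right c) < c"
      using left_le[of "right c"] right_le[of "right c"] by linarith+
    then have "ev (left (right c)) p S \<longleftrightarrow> ev (left (right c)) p S'"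
      "ev (right (right c)) p S \<longleftrightarrow> ev (right (right c)) p S'"
      using less.prems by (intro less.IH; auto)+
    then show ?thesis using 2 by (simp add: ev.simps[of c])
  next
    case 3
    then have "right c < c" by (simp add: right_less)
    then have "S \<noteq> {}" using less.prems(1) by auto
    then have "lo S \<in> S" by (rule lo_in)
    have lo: "lo S' = lo S"
    proof (rule lo_eqI)
      show "lo S \<in> S'" using \<open>lo S \<in> S\<close> less.prems(2) by blast
      show "lo S \<le> y" if "y \<in> S'" for y
        using that \<open>lo S \<in> S\<close> less.prems(3)[of "lo S" y] lo_le[of y S] by (cases "y \<in> S") auto
    qed
    have "ev (right c) q (rest S) \<longleftrightarrow> ev (right c) q (rest S')" for q
    proof (rule less.IH[OF \<open>right c < c\<close>])
      \<comment> \<open>The quantifier spends one bound, and the code drops by at least one.\<close>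
      show "right c \<le> card (rest S)" using \<open>right c < c\<close> less.prems(1) by (simp add: card_rest)
      show "rest S \<subseteq> rest S'" unfolding rest_def lo using less.prems(2) by blast
      show "x < y" if "x \<in> rest S" "y \<in> rest S' - rest S" for x y
        using that unfolding rest_def lo by (intro less.prems(3)) auto
    qed
    then show ?thesis using 3 by (simp add: ev.simps[of c] lo)
  qed
qed

section \<open>Homogeneous sets decide truth\<close>

text \<open>\<open>rest X\<close> can stand for the first half because a formula with code at most
  \<open>lo X div 2\<close> is settled by that many bounds. Iterating \<open>rest\<close> removes
  this half and leaves the second one.\<close>

definition colour :: "nat set \<Rightarrow> nat" where
  "colour X = (if \<forall>c<Suc (lo X div 2). \<forall>p<lo X.
      ev c p (rest X) \<longleftrightarrow> ev c p ((rest ^^ (lo X div 2)) (rest X)) then 1 else 0)"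

lemma colour_insert_Un:
  assumes "finite S" "card S = a div 2" "\<And>x. x \<in> S \<union> T \<Longrightarrow> a < x"
    and ST: "\<And>x y. x \<in> S \<Longrightarrow> y \<in> T \<Longrightarrow> x < y"
  shows "colour (insert a (S \<union> T)) = 1 \<longleftrightarrow> (\<forall>c\<le>a div 2. \<forall>p<a. ev c p S \<longleftrightarrow> ev c p T)"
proof -
  have "lo (insert a (S \<union> T)) = a" "rest (insert a (S \<union> T)) = S \<union> T"
    using assms(3) by (intro lo_insert rest_insert; blast)+
  moreover have "(rest ^^ (a div 2)) (S \<union> T) = T" using assms by (intro funpow_rest_Un) auto
  moreover have "ev c p S \<longleftrightarrow> ev c p (S \<union> T)" if "c \<le> a div 2" for c p
    using that assms by (intro ev_end_extension) auto
  ultimately show ?thesis by (auto simp: colour_def less_Suc_eq_le)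
qed

lemma exactly_large_insert_Un:
  assumes "finite S" "finite T" "card S = a div 2" "card T = a - a div 2"
    and "\<And>x. x \<in> S \<union> T \<Longrightarrow> a < x" and "\<And>x y. x \<in> S \<Longrightarrow> y \<in> T \<Longrightarrow> x < y"
  shows "exactly_large (insert a (S \<union> T))"
proof -
  have "S \<inter> T = {}" using assms(6) by blast
  then have "card (S \<union> T) = a" using assms by (simp add: card_Un_disjoint)
  moreover have "a \<notin> S \<union> T" using assms(5) by blast
  moreover have "Min (insert a (S \<union> T)) = a"
    using assms by (intro Min_eqI) (auto intro: less_imp_le)
  ultimately show ?thesis using assms(1,2) by (simp add: exactly_large_def)
qed

lemma initial_segment:
  assumes "infinite (G :: nat set)"
  obtains S where "S \<subseteq> G" "finite S" "card S = n" "\<forall>x\<in>S. \<forall>y\<in>G - S. x < y"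
proof (induction n arbitrary: thesis)
  case 0
  show ?case by (rule 0[of "{}"]) auto
next
  case (Suc n)
  obtain S where S: "S \<subseteq> G" "finite S" "card S = n" "\<forall>x\<in>S. \<forall>y\<in>G - S. x < y"
    by (rule Suc.IH)
  have "G - S \<noteq> {}" using assms S(2) by (metis Diff_eq_empty_iff finite_subset)
  then have l: "lo (G - S) \<in> G - S" by (rule lo_in)
  show ?case
  proof (rule Suc.prems[of "insert (lo (G - S)) S"])
    show "\<forall>x\<in>insert (lo (G - S)) S. \<forall>y\<in>G - insert (lo (G - S)) S. x < y"
      using S(4) lo_le[of _ "G - S"] by (auto simp: le_less)
  qed (use S l in auto)
qed

lemma ev_initial_segment:
  assumes "S \<subseteq> G" "c \<le> card S" "\<forall>x\<in>S. \<forall>y\<in>G - S. x < y"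
  shows "ev c p S \<longleftrightarrow> ev c p G"
  using assms by (intro ev_end_extension) auto

lemma infinite_tail:
  assumes "infinite (H :: nat set)"
  shows "infinite (H \<inter> {k<..})"
proof -
  have "H \<inter> {k<..} = H - {..k}" by auto
  then show ?thesis using assms by (simp add: Diff_infinite_finite)
qed

text \<open>
  Only finitely many formulas and parameters are compared by sets with minimum \<open>a\<close>, so two tails
  of \<open>H\<close> agree on all of them.
\<close>

lemma exists_colour_1:
  assumes "infinite H"
  shows "\<exists>X\<in>exactly_large_subsets H. colour X = 1"
proof -
  obtain a where "a \<in> H" using assms by (metis all_not_in_conv finite.emptyI)
  define n where "n = a div 2"
  define pattern where "pattern k = {(c, p). c \<le> n \<and> p < a \<and> ev c p (H \<inter> {k<..})}" for k
  have "range pattern \<subseteq> Pow ({..n} \<times> {..<a})" by (auto simp: pattern_def)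
  then have "finite (range pattern)" by (rule finite_subset) auto
  then obtain k0 where K: "infinite {k. pattern k = pattern k0}"
    using pigeonhole_infinite[OF infinite_UNIV_nat] by auto
  obtain k where k: "k > a" "pattern k = pattern k0"
    using K unfolding infinite_nat_iff_unbounded by auto
  obtain S where S: "S \<subseteq> H \<inter> {k<..}" "finite S" "card S = n"
      "\<forall>x\<in>S. \<forall>y\<in>H \<inter> {k<..} - S. x < y"
    by (rule initial_segment[OF infinite_tail[OF assms]])
  \<comment> \<open>The pattern recurs beyond every number, so \<open>l\<close> can be chosen after
    \<open>S\<close>; this puts \<open>T\<close> above \<open>S\<close>.\<close>
  obtain l where l: "l > Max (insert a S)" "pattern l = pattern k0"
    using K unfolding infinite_nat_iff_unbounded by auto
  obtain T where T: "T \<subseteq> H \<inter> {l<..}" "finite T" "card T = a - n"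
      "\<forall>x\<in>T. \<forall>y\<in>H \<inter> {l<..} - T. x < y"
    by (rule initial_segment[OF infinite_tail[OF assms]])
  have ST: "a < x" if "x \<in> S \<union> T" for x
    using that S(1) T(1) k(1) l(1) S(2) by auto
  have ST': "x < y" if "x \<in> S" "y \<in> T" for x y
    using that T(1) l(1) S(2) by fastforce
  have "ev c p S \<longleftrightarrow> ev c p T" if "c \<le> n" "p < a" for c p
  proof -
    have "ev c p S \<longleftrightarrow> ev c p (H \<inter> {k<..})" using S that by (intro ev_initial_segment) auto
    also have "\<dots> \<longleftrightarrow> (c, p) \<in> pattern k" using that by (simp add: pattern_def)
    also have "\<dots> \<longleftrightarrow> (c, p) \<in> pattern l" using k l by simp
    also have "\<dots> \<longleftrightarrow> ev c p (H \<inter> {l<..})" using that by (simp add: pattern_def)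
    also have "\<dots> \<longleftrightarrow> ev c p T"
      using T that by (intro ev_initial_segment[symmetric]) (auto simp: n_def)
    finally show ?thesis .
  qed
  then have "colour (insert a (S \<union> T)) = 1"
    using S ST ST' by (subst colour_insert_Un) (auto simp: n_def)
  moreover have "exactly_large (insert a (S \<union> T))"
    using S T ST ST' by (intro exactly_large_insert_Un) (auto simp: n_def)
  moreover have "insert a (S \<union> T) \<subseteq> H" using S(1) T(1) \<open>a \<in> H\<close> by blast
  ultimately show ?thesis unfolding exactly_large_subsets_def by blast
qed

text \<open>The initial segments of \<open>G1\<close> and \<open>G2\<close> may interleave and
  cannot form the two halves of one set. Each is compared with a common second half \<open>T\<close>
  lying beyond both, through two sets of colour 1, the only colour left by
  \<open>exists_colour_1\<close>.\<close>

lemma ev_tails_agree: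
  assumes H: "infinite H" "homogeneous colour H"
    and a: "a \<in> H" "c \<le> a div 2" "p < a"
    and G: "G1 \<subseteq> H \<inter> {a<..}" "infinite G1" "G2 \<subseteq> H \<inter> {a<..}" "infinite G2"
  shows "ev c p G1 \<longleftrightarrow> ev c p G2"
proof -
  have one: "colour X = 1" if "X \<in> exactly_large_subsets H" for X
    using H(2) exists_colour_1[OF H(1)] that unfolding homogeneous_def by metis
  have *: "\<exists>m. \<forall>T \<subseteq> H \<inter> {m<..}. finite T \<and> card T = a - a div 2 \<longrightarrow> (ev c p G \<longleftrightarrow> ev c p T)"
    if G: "G \<subseteq> H \<inter> {a<..}" "infinite G" for G
  proof -
    obtain S where S: "S \<subseteq> G" "finite S" "card S = a div 2"
        "\<forall>x\<in>S. \<forall>y\<in>G - S. x < y"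
      by (rule initial_segment[OF G(2)])
    have "ev c p G \<longleftrightarrow> ev c p T"
      if T: "T \<subseteq> H \<inter> {Max (insert a S)<..}" "finite T" "card T = a - a div 2" for T
    proof -
      have ST: "a < x" if "x \<in> S \<union> T" for x using that S(1,2) T(1) G(1) by auto
      have ST': "x < y" if "x \<in> S" "y \<in> T" for x y using that S(2) T(1) by auto
      have "insert a (S \<union> T) \<subseteq> H" using S(1) T(1) G(1) a(1) by blast
      moreover have "exactly_large (insert a (S \<union> T))"
        using S T ST ST' by (intro exactly_large_insert_Un) auto
      ultimately have "colour (insert a (S \<union> T)) = 1"
        by (intro one) (simp add: exactly_large_subsets_def)
      then have "ev c p S \<longleftrightarrow> ev c p T"
        using S ST ST' a(2,3) by (subst (asm) colour_insert_Un) auto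
      then show ?thesis using ev_initial_segment[of S G c p] S a(2) by auto
    qed
    then show ?thesis by blast
  qed
  obtain m1 where m1:
      "T \<subseteq> H \<inter> {m1<..} \<Longrightarrow> finite T \<Longrightarrow> card T = a - a div 2 \<Longrightarrow>
        (ev c p G1 \<longleftrightarrow> ev c p T)" for T
    using *[OF G(1,2)] by blast
  obtain m2 where m2:
      "T \<subseteq> H \<inter> {m2<..} \<Longrightarrow> finite T \<Longrightarrow> card T = a - a div 2 \<Longrightarrow>
        (ev c p G2 \<longleftrightarrow> ev c p T)" for T
    using *[OF G(3,4)] by blast
  obtain T where T: "T \<subseteq> H \<inter> {max m1 m2<..}" "finite T" "card T = a - a div 2"
    by (rule initial_segment[OF infinite_tail[OF H(1)]])
  then have "T \<subseteq> H \<inter> {m1<..}" "T \<subseteq> H \<inter> {m2<..}" by auto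
  with m1 m2 T(2,3) show ?thesis by blast
qed

lemma ev_eq_sat_infinite:
  assumes H: "infinite H" "homogeneous colour H"
    and "a \<in> H" "c \<le> a div 2" "p < a" "G \<subseteq> H \<inter> {a<..}" "infinite G"
  shows "ev c p G \<longleftrightarrow> sat c p"
  using assms(3-)
proof (induction c arbitrary: a p G rule: less_induct)
  case (less c)
  consider "left c = 0" | "left c = 1" | "left c \<noteq> 0" "left c \<noteq> 1" by blast
  then show ?case
  proof cases
    case 1
    then show ?thesis by (simp add: ev.simps[of c] sat.simps[of c])
  next
    case 2
    then have "right c < c" by (simp add: right_less)
    then have "left (right c) < c" "right (right c) < c"
      using left_le[of "right c"] right_le[of "right c"] by linarith+
    then have "ev (left (right c)) p G \<longleftrightarrow> sat (left (right c)) p"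
      "ev (right (right c)) p G \<longleftrightarrow> sat (right (right c)) p"
      using less.prems by (intro less.IH[of _ a]; auto)+
    then show ?thesis using 2 by (simp add: ev.simps[of c] sat.simps[of c])
  next
    case 3
    then have c: "right c < c" by (simp add: right_less)
    \<comment> \<open>Below the quantifier, \<open>lo G'\<close> takes over the role of
      \<open>a\<close>: it lies in \<open>H\<close>, exceeds the new parameter \<open>q\<close>, and
      precedes all of \<open>rest G'\<close>.\<close>
    have bounded: "ev c p G' \<longleftrightarrow> (\<exists>q<lo G'. right q = p \<and> sat (right c) q)"
      if G': "G' \<subseteq> H \<inter> {a<..}" "infinite G'" for G'
    proof -
      have lo: "lo G' \<in> G'" using G'(2) by (intro lo_in) auto
      have "ev (right c) q (rest G') \<longleftrightarrow> sat (right c) q" if "q < lo G'" for q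
      proof (rule less.IH[OF c, of "lo G'"])
        have "a \<le> lo G'" using lo G'(1) by auto
        then show "right c \<le> lo G' div 2"
          using c less.prems(2) div_le_mono[of a "lo G'" 2] by linarith
        show "rest G' \<subseteq> H \<inter> {lo G'<..}"
          using G'(1) lo_less_rest[of _ G'] unfolding rest_def by blast
        show "infinite (rest G')" using G'(2) by (simp add: rest_def)
      qed (use lo G' that in auto)
      then show ?thesis using 3 by (auto simp: ev.simps[of c])
    qed
    show ?thesis
    proof
      assume "ev c p G"
      then show "sat c p" using bounded[OF less.prems(4,5)] 3 by (auto simp: sat.simps[of c])
    next
      assume "sat c p"
      then obtain q where q: "right q = p" "sat (right c) q" using 3 by (auto simp: sat.simps[of c])
      \<comment> \<open>The witness \<open>q\<close> may exceed the first bound in \<open>G\<close>.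
        In the tail beyond \<open>q\<close> it is admissible, and \<open>ev_tails_agree\<close>
        carries the value back to \<open>G\<close>.\<close>
      let ?G = "G \<inter> {q<..}"
      have G: "?G \<subseteq> H \<inter> {a<..}" "infinite ?G" using less.prems infinite_tail by auto
      then have "lo ?G \<in> ?G" by (intro lo_in) auto
      then have "ev c p ?G" using bounded[OF G] q by auto
      then show "ev c p G" using ev_tails_agree[OF H less.prems(1-3) G less.prems(4,5)] by simp
    qed
  qed
qed

text \<open>A certificate for the truth of \<open>c\<close> at \<open>p\<close>: the minimum of
  \<open>Z\<close> licenses \<open>c\<close> and \<open>p\<close>, and the third conjunct, for
  finite \<open>Z\<close>, leaves at least \<open>c\<close> bounds in \<open>rest Z\<close>.\<close>

definition decides :: "nat \<Rightarrow> nat \<Rightarrow> nat set \<Rightarrow> bool" where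
  "decides c p Z \<longleftrightarrow> c < Suc (lo Z div 2) \<and> p < lo Z \<and> (rest ^^ c) Z \<noteq> {} \<and> ev c p (rest Z)"

lemma sat_iff_decides:
  assumes H: "infinite H" "homogeneous colour H"
  shows "sat c p \<longleftrightarrow> (\<exists>Z. finite Z \<and> Z \<subseteq> H \<and> decides c p Z)"
proof
  assume sat: "sat c p"
  \<comment> \<open>This size gives both \<open>c <= a div 2\<close> and
    \<open>p < a\<close>.\<close>
  obtain a where a: "a \<in> H" "a > 2 * c + p"
    using H(1) unfolding infinite_nat_iff_unbounded by auto
  let ?G = "H \<inter> {a<..}"
  obtain S where S: "S \<subseteq> ?G" "finite S" "card S = c" "\<forall>x\<in>S. \<forall>y\<in>?G - S. x < y"
    by (rule initial_segment[OF infinite_tail[OF H(1)]])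
  have "ev c p ?G"
    using ev_eq_sat_infinite[OF H a(1), of c p ?G] a(2) sat infinite_tail[OF H(1)] by auto
  then have "ev c p S" using ev_initial_segment[of S ?G c p] S by auto
  moreover have "lo (insert a S) = a" "rest (insert a S) = S"
    using S(1) by (auto intro!: lo_insert rest_insert)
  moreover have "a \<notin> S" using S(1) by auto
  then have "card (insert a S) = Suc c" using S(2,3) by simp
  ultimately have "decides c p (insert a S)"
    using a(2) S(2) by (simp add: decides_def funpow_rest_nonempty_iff del: funpow.simps)
  moreover have "finite (insert a S)" "insert a S \<subseteq> H" using S a(1) by auto
  ultimately show "\<exists>Z. finite Z \<and> Z \<subseteq> H \<and> decides c p Z" by blast
next
  assume "\<exists>Z. finite Z \<and> Z \<subseteq> H \<and> decides c p Z"
  then obtain Z where Z: "finite Z" "Z \<subseteq> H" "decides c p Z" by blast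
  then have card: "c < card Z" by (simp add: decides_def funpow_rest_nonempty_iff)
  then have lo: "lo Z \<in> Z" by (intro lo_in) auto
  \<comment> \<open>Truth is known for infinite sets of bounds only, so \<open>rest Z\<close> is
    prolonged inside \<open>H\<close>; the bounds already present settle the value.\<close>
  define G where "G = rest Z \<union> (H \<inter> {Max Z<..})"
  have "ev c p (rest Z) \<longleftrightarrow> ev c p G"
  proof (rule ev_initial_segment)
    show "c \<le> card (rest Z)" using card by (simp add: card_rest)
    have "x \<le> Max Z" if "x \<in> rest Z" for x using that Z(1) by (simp add: rest_def)
    then show "\<forall>x\<in>rest Z. \<forall>y\<in>G - rest Z. x < y" by (fastforce simp: G_def)
  qed (auto simp: G_def)
  also have "\<dots> \<longleftrightarrow> sat c p"
  proof (rule ev_eq_sat_infinite[OF H, of "lo Z"])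
    show "G \<subseteq> H \<inter> {lo Z<..}"
    proof
      fix x assume x: "x \<in> G"
      show "x \<in> H \<inter> {lo Z<..}"
      proof (cases "x \<in> rest Z")
        case True
        then show ?thesis using lo_less_rest Z(2) by (auto simp: rest_def)
      next
        case False
        then have "x \<in> H" "Max Z < x" using x by (auto simp: G_def)
        moreover have "lo Z \<le> Max Z" using lo Z(1) by simp
        ultimately show ?thesis by simp
      qed
    qed
    show "infinite G" using infinite_tail[OF H(1)] by (simp add: G_def)
  qed (use Z lo in \<open>auto simp: decides_def\<close>)
  finally show "sat c p" using Z(3) by (simp add: decides_def)
qed

section \<open>Computability of bounded evaluation\<close>

lemma set_decode_eq_empty_iff: "set_decode z = {} \<longleftrightarrow> z = 0"
  by (metis set_decode_inverse set_decode_zero set_encode_empty)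

lemma set_decode_less: "x \<in> set_decode z \<Longrightarrow> x < z"
proof -
  assume "x \<in> set_decode z"
  then have "2 ^ x \<le> (\<Sum>i\<in>set_decode z. 2 ^ i :: nat)"
    by (intro member_le_sum) auto
  also have "\<dots> = z" using set_decode_inverse[of z] by (simp add: set_encode_def)
  finally show "x < z" using less_exp[of x] by linarith
qed

definition rest_code :: "nat \<Rightarrow> nat" where
  "rest_code z = set_encode (rest (set_decode z))"

lemma set_decode_rest_code: "set_decode (rest_code z) = rest (set_decode z)"
  by (simp add: rest_code_def finite_rest)

lemma rest_code_le: "rest_code z \<le> z"
proof -
  have "rest_code z \<le> set_encode (set_decode z)"
    unfolding rest_code_def set_encode_def rest_def by (rule sum_mono2) auto
  then show ?thesis by simp
qed

lemma lo_set_decode_le: "lo (set_decode z) \<le> z"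
proof (cases "z = 0")
  case False
  then have "lo (set_decode z) \<in> set_decode z" by (intro lo_in) (simp add: set_decode_eq_empty_iff)
  then show ?thesis by (intro less_imp_le set_decode_less)
qed (simp add: lo_def)

lemma rec_fun_lo: "rec_fun A \<Longrightarrow> rec_fun (\<lambda>e. lo (set_decode (A e)))"
proof (rule rec_fun_comp1[of "\<lambda>z. lo (set_decode z)"], rule rec_fun_graph)
  show "rec_rel (\<lambda>e. e (Suc 0) = 0 \<and> e 0 = 0 \<or>
      e 0 \<in> set_decode (e (Suc 0)) \<and> (\<forall>x<e 0. x \<notin> set_decode (e (Suc 0))))"
    by (intro rec_rel_disj rec_rel_conj rec_rel_ball rec_rel_not rec_rel_mem rec_rel_eq
        rec_fun_const rec_fun_var)
  show "e 0 = 0 \<and> y = 0 \<or> y \<in> set_decode (e 0) \<and> (\<forall>x<y. x \<notin> set_decode (e 0)) \<longleftrightarrow>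
      y = lo (set_decode (e 0))" for y and e :: "nat \<Rightarrow> nat"
  proof (cases "e 0 = 0")
    case False
    then have "lo (set_decode (e 0)) \<in> set_decode (e 0)"
      by (intro lo_in) (simp add: set_decode_eq_empty_iff)
    then show ?thesis using False lo_le[of _ "set_decode (e 0)"]
      by (metis linorder_neqE_nat not_le)
  qed (simp add: lo_def)
qed

lemma rec_fun_rest_code: "rec_fun A \<Longrightarrow> rec_fun (\<lambda>e. rest_code (A e))"
proof (rule rec_fun_comp1[of rest_code], rule rec_fun_graph)
  \<comment> \<open>The bound on the candidate \<open>e 0\<close> keeps its members below the input,
    so the bounded check determines the whole set.\<close>
  show "rec_rel (\<lambda>e. e 0 < Suc (e (Suc 0)) \<and> (\<forall>x<e (Suc 0). x \<in> set_decode (e 0) \<longleftrightarrow>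
      x \<in> set_decode (e (Suc 0)) \<and> x \<noteq> lo (set_decode (e (Suc 0)))))"
    by (intro rec_rel_conj rec_rel_ball rec_rel_iff rec_rel_not rec_rel_mem rec_rel_eq rec_rel_less
        rec_fun_Suc rec_fun_lo rec_fun_var)
  show "y < Suc (e 0) \<and> (\<forall>x<e 0. x \<in> set_decode y \<longleftrightarrow>
      x \<in> set_decode (e 0) \<and> x \<noteq> lo (set_decode (e 0))) \<longleftrightarrow> y = rest_code (e 0)" (is "?L \<longleftrightarrow> ?R")
    for y and e :: "nat \<Rightarrow> nat"
  proof
    assume L: ?L
    have "x \<in> set_decode y \<longleftrightarrow> x \<in> rest (set_decode (e 0))" for x
    proof (cases "x < e 0")
      case True
      then show ?thesis using L by (simp add: rest_def)
    next
      case False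
      then have "x \<notin> set_decode y" "x \<notin> set_decode (e 0)"
        using L set_decode_less[of x y] set_decode_less[of x "e 0"] by auto
      then show ?thesis by (simp add: rest_def)
    qed
    then have "set_decode y = set_decode (rest_code (e 0))" by (simp add: set_decode_rest_code set_eq_iff)
    then show ?R by (metis set_decode_inverse)
  next
    assume ?R
    then show ?L by (simp add: set_decode_rest_code less_Suc_eq_le rest_code_le) (simp add: rest_def)
  qed
qed

lemma set_decode_funpow_rest_code: "set_decode ((rest_code ^^ n) z) = (rest ^^ n) (set_decode z)"
  by (induction n) (simp_all add: set_decode_rest_code)

lemma rec_fun_entry: "rec_fun A \<Longrightarrow> rec_fun B \<Longrightarrow> rec_fun (\<lambda>e. entry (A e) (B e))"
  unfolding entry_def by (intro rec_fun_left rec_fun_funpow rec_fun_right rec_fun_var)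

lemma rec_rel_atomic: "rec_fun A \<Longrightarrow> rec_fun B \<Longrightarrow> rec_rel (\<lambda>e. atomic (A e) (B e))"
  unfolding atomic_def atom_def
  by (intro rec_rel_if rec_rel_eq rec_rel_less rec_rel_mem rec_fun_prod_encode rec_fun_entry
      rec_fun_left rec_fun_right rec_fun_const)

text \<open>
  A table is the code of a set of triples. The recursion defining \<open>ev\<close> from \<open>c0\<close> with
  parameters below \<open>m\<close> never leaves the box in which a valid table is correct.
\<close>

definition in_table :: "nat \<Rightarrow> nat \<Rightarrow> nat \<Rightarrow> nat \<Rightarrow> bool" where
  "in_table T c p z \<longleftrightarrow> prod_encode (c, prod_encode (p, z)) \<in> set_decode T"

definition valid_table :: "nat \<Rightarrow> nat \<Rightarrow> nat \<Rightarrow> bool" where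
  "valid_table T c0 m \<longleftrightarrow> (\<forall>c<Suc c0. \<forall>p<m. \<forall>z<m. in_table T c p z \<longleftrightarrow>
    (if left c = 0 then atomic (right c) p
     else if left c = 1 then \<not> (in_table T (left (right c)) p z \<and> in_table T (right (right c)) p z)
     else \<exists>q<lo (set_decode z). right q = p \<and> in_table T (right c) q (rest_code z)))"

text \<open>The quantifier case stays in the box since \<open>q < lo (set_decode z) <= z < m\<close>
  and \<open>rest_code z <= z\<close>; the induction on \<open>c\<close> then fixes every
  entry.\<close>

lemma valid_table_correct:
  assumes "valid_table T c0 m" "c \<le> c0" "p < m" "z < m"
  shows "in_table T c p z \<longleftrightarrow> ev c p (set_decode z)"
  using assms(2-)
proof (induction c arbitrary: p z rule: less_induct)
  case (less c)
  have *: "in_table T c p z \<longleftrightarrow>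
    (if left c = 0 then atomic (right c) p
     else if left c = 1 then \<not> (in_table T (left (right c)) p z \<and> in_table T (right (right c)) p z)
     else \<exists>q<lo (set_decode z). right q = p \<and> in_table T (right c) q (rest_code z))"
    using assms(1) less.prems unfolding valid_table_def less_Suc_eq_le by blast
  consider "left c = 0" | "left c = 1" | "left c \<noteq> 0" "left c \<noteq> 1" by blast
  then show ?case
  proof cases
    case 1
    then show ?thesis using * by (simp add: ev.simps[of c])
  next
    case 2
    then have "right c < c" by (simp add: right_less)
    then have "left (right c) < c" "right (right c) < c"
      using left_le[of "right c"] right_le[of "right c"] by linarith+
    then have "in_table T (left (right c)) p z \<longleftrightarrow> ev (left (right c)) p (set_decode z)"
      "in_table T (right (right c)) p z \<longleftrightarrow> ev (right (right c)) p (set_decode z)"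
      using less.prems by (intro less.IH; simp)+
    then show ?thesis using 2 * by (simp add: ev.simps[of c])
  next
    case 3
    then have "right c < c" by (simp add: right_less)
    then have "in_table T (right c) q (rest_code z) \<longleftrightarrow> ev (right c) q (rest (set_decode z))"
      if "q < lo (set_decode z)" for q
      using less.IH[of "right c" q "rest_code z"] less.prems that
        lo_set_decode_le[of z] rest_code_le[of z] by (simp add: set_decode_rest_code)
    then show ?thesis using 3 * by (auto simp: ev.simps[of c])
  qed
qed

lemma valid_table_exists: "\<exists>T. valid_table T c0 m"
proof
  define K where "K = {k. left k \<le> c0 \<and> left (right k) < m \<and> right (right k) < m \<and>
    ev (left k) (left (right k)) (set_decode (right (right k)))}"
  have "K \<subseteq> (\<lambda>(c, p, z). prod_encode (c, prod_encode (p, z))) ` ({..c0} \<times> {..<m} \<times> {..<m})"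
  proof
    fix k assume "k \<in> K"
    then show "k \<in> (\<lambda>(c, p, z). prod_encode (c, prod_encode (p, z))) ` ({..c0} \<times> {..<m} \<times> {..<m})"
      by (intro image_eqI[of _ _ "(left k, left (right k), right (right k))"]) (auto simp: K_def mem_Times_iff)
  qed
  then have "finite K" by (rule finite_subset) auto
  then have T: "in_table (set_encode K) c p z \<longleftrightarrow> ev c p (set_decode z)"
    if "c \<le> c0" "p < m" "z < m" for c p z
    using that by (simp add: in_table_def K_def)
  show "valid_table (set_encode K) c0 m"
    unfolding valid_table_def
  proof (intro allI impI)
    fix c p z assume cpz: "c < Suc c0" "p < m" "z < m"
    consider "left c = 0" | "left c = 1" | "left c \<noteq> 0" "left c \<noteq> 1" by blast
    then show "in_table (set_encode K) c p z \<longleftrightarrow>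
      (if left c = 0 then atomic (right c) p
       else if left c = 1 then \<not> (in_table (set_encode K) (left (right c)) p z \<and>
         in_table (set_encode K) (right (right c)) p z)
       else \<exists>q<lo (set_decode z). right q = p \<and> in_table (set_encode K) (right c) q (rest_code z))"
    proof cases
      case 2
      have "left (right c) \<le> c0" "right (right c) \<le> c0"
        using cpz(1) left_le[of "right c"] right_le[of "right c"] right_le[of c] by linarith+
      then show ?thesis using 2 cpz by (simp add: T ev.simps[of c])
    next
      case 3
      have "right c \<le> c0" using cpz(1) right_le[of c] by linarith
      then have "in_table (set_encode K) (right c) q (rest_code z) \<longleftrightarrow>
          ev (right c) q (rest (set_decode z))" if "q < lo (set_decode z)" for q
        using cpz that lo_set_decode_le[of z] rest_code_le[of z]
        by (simp add: T set_decode_rest_code)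
      then show ?thesis using 3 cpz by (auto simp: T ev.simps[of c])
    qed (use cpz in \<open>simp add: T ev.simps[of c]\<close>)
  qed
qed

lemma rec_rel_in_table:
  "rec_fun A \<Longrightarrow> rec_fun B \<Longrightarrow> rec_fun C \<Longrightarrow> rec_fun D \<Longrightarrow> rec_rel (\<lambda>e. in_table (A e) (B e) (C e) (D e))"
  unfolding in_table_def by (intro rec_rel_mem rec_fun_prod_encode)

text \<open>The recursion for \<open>ev\<close> changes its parameters and branches, so it does not
  fit the schema of primitive recursion. An unbounded search for a valid table replaces it: one
  exists, and any one gives the right answer.\<close>

lemma rec_rel_ev:
  "rec_fun A \<Longrightarrow> rec_fun B \<Longrightarrow> rec_fun C \<Longrightarrow> rec_rel (\<lambda>e. ev (A e) (B e) (set_decode (C e)))"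
proof (rule rec_rel_comp3[of "\<lambda>c p z. ev c p (set_decode z)"])
  have valid: "rec_rel (\<lambda>e. valid_table (e 0) (e 1) (e 2))"
    unfolding valid_table_def
    by (intro rec_rel_ball rec_rel_bex rec_rel_iff rec_rel_if rec_rel_eq rec_rel_not rec_rel_conj
        rec_rel_in_table rec_rel_atomic rec_fun_lo rec_fun_rest_code rec_fun_left rec_fun_right
        rec_fun_Suc rec_fun_const rec_fun_var)
  \<comment> \<open>The side \<open>Suc (p + z)\<close> of the box exceeds both \<open>p\<close> and
    \<open>z\<close>.\<close>
  have "rec_rel (\<lambda>e. in_table (LEAST T. valid_table T (e 0) (Suc (e 1 + e 2))) (e 0) (e 1) (e 2))"
    by (intro rec_rel_in_table rec_fun_Least valid_table_exists rec_rel_comp3[OF valid]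
        rec_fun_Suc rec_fun_plus rec_fun_var)
  moreover have "in_table (LEAST T. valid_table T c (Suc (p + z))) c p z \<longleftrightarrow> ev c p (set_decode z)" for c p z
    using LeastI_ex[OF valid_table_exists] by (intro valid_table_correct) auto
  ultimately show "rec_rel (\<lambda>e. ev (e 0) (e 1) (set_decode (e 2)))" by simp
qed

lemma rec_rel_decides:
  assumes "rec_fun A" "rec_fun B" "rec_fun C"
  shows "rec_rel (\<lambda>e. decides (A e) (B e) (set_decode (C e)))"
proof -
  have "rec_rel (\<lambda>e. A e < Suc (lo (set_decode (C e)) div 2) \<and> B e < lo (set_decode (C e)) \<and>
      (rest_code ^^ A e) (C e) \<noteq> 0 \<and> ev (A e) (B e) (set_decode (rest_code (C e))))"
    by (intro rec_rel_conj rec_rel_not rec_rel_less rec_rel_eq rec_rel_ev rec_fun_half rec_fun_lo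
        rec_fun_Suc rec_fun_funpow rec_fun_rest_code rec_fun_const rec_fun_var assms)
  then show ?thesis
    by (simp add: decides_def set_decode_rest_code flip: set_decode_eq_empty_iff set_decode_funpow_rest_code)
qed

lemma computable_coloring_colour: "computable_coloring colour"
proof -
  have "rec_rel (\<lambda>e. \<forall>c<Suc (lo (set_decode (e 0)) div 2). \<forall>p<lo (set_decode (e 0)).
      ev c p (set_decode (rest_code (e 0))) \<longleftrightarrow>
      ev c p (set_decode ((rest_code ^^ (lo (set_decode (e 0)) div 2)) (rest_code (e 0)))))"
    by (intro rec_rel_ball rec_rel_iff rec_rel_ev rec_fun_half rec_fun_lo
        rec_fun_funpow rec_fun_rest_code rec_fun_Suc rec_fun_var)
  then have "rec_fun (\<lambda>e. colour (set_decode (e 0)))"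
    unfolding rec_rel_def colour_def set_decode_rest_code set_decode_funpow_rest_code .
  then have "recursive_fn 1 (\<lambda>xs. colour (set_decode (xs ! 0)))"
    by (rule recursive_fn_1_if_rec_fun)
  moreover have "finite X" if "X \<in> exactly_large_subsets UNIV" for X
    using that by (simp add: exactly_large_subsets_def exactly_large_def)
  ultimately show ?thesis unfolding computable_coloring_def by (intro exI conjI) auto
qed

section \<open>Arithmetical predicates\<close>

text \<open>Definability by one formula over the coded environments. Quantifier complexity is
  deliberately forgotten.\<close>

definition arithmetical :: "((nat \<Rightarrow> nat) \<Rightarrow> bool) \<Rightarrow> bool" where
  "arithmetical P \<longleftrightarrow> (\<exists>c. \<forall>p. sat c p \<longleftrightarrow> P (entry p))"

lemma arithmetical_atom: "arithmetical (\<lambda>e. atom (e i) (e j) (e k))"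
  unfolding arithmetical_def
  by (rule exI[of _ "prod_encode (0, prod_encode (i, prod_encode (j, k)))"])
    (simp add: sat.simps[of "prod_encode _"] atomic_def)

lemma arithmetical_nand:
  assumes "arithmetical P" "arithmetical Q"
  shows "arithmetical (\<lambda>e. \<not> (P e \<and> Q e))"
proof -
  obtain c d where "\<forall>p. sat c p \<longleftrightarrow> P (entry p)" "\<forall>p. sat d p \<longleftrightarrow> Q (entry p)"
    using assms unfolding arithmetical_def by blast
  then show ?thesis unfolding arithmetical_def
    by (intro exI[of _ "prod_encode (1, prod_encode (c, d))"]) (simp add: sat.simps[of "prod_encode _"])
qed

lemma arithmetical_not: "arithmetical P \<Longrightarrow> arithmetical (\<lambda>e. \<not> P e)"
  using arithmetical_nand[of P P] by simp

lemma arithmetical_conj: "arithmetical P \<Longrightarrow> arithmetical Q \<Longrightarrow> arithmetical (\<lambda>e. P e \<and> Q e)"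
  using arithmetical_not[OF arithmetical_nand[of P Q]] by simp

lemma arithmetical_imp: "arithmetical P \<Longrightarrow> arithmetical Q \<Longrightarrow> arithmetical (\<lambda>e. P e \<longrightarrow> Q e)"
  using arithmetical_nand[of P "\<lambda>e. \<not> Q e"] arithmetical_not[of Q] by simp

lemma arithmetical_ex:
  assumes "arithmetical (\<lambda>e. P (e 0) (\<lambda>i. e (Suc i)))"
  shows "arithmetical (\<lambda>e. \<exists>y. P y e)"
proof -
  obtain c where c: "\<And>q. sat c q \<longleftrightarrow> P (left q) (entry (right q))"
    using assms unfolding arithmetical_def entry_0 entry_Suc by auto
  have "sat (prod_encode (2, c)) p \<longleftrightarrow> (\<exists>y. P y (entry p))" for p
  proof -
    have "sat (prod_encode (2, c)) p \<longleftrightarrow> (\<exists>q. right q = p \<and> P (left q) (entry (right q)))"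
      by (simp add: sat.simps[of "prod_encode _"] c)
    also have "\<dots> \<longleftrightarrow> (\<exists>y. P y (entry p))"
      by (metis fst_conv prod_encode_inverse snd_conv)
    finally show ?thesis .
  qed
  then show ?thesis unfolding arithmetical_def by blast
qed

lemma arithmetical_all:
  assumes "arithmetical (\<lambda>e. P (e 0) (\<lambda>i. e (Suc i)))"
  shows "arithmetical (\<lambda>e. \<forall>y. P y e)"
  using arithmetical_not[OF arithmetical_ex[OF arithmetical_not[OF assms]]] by simp

text \<open>
  Infinitely many pairs \<open>(b, a)\<close> have to satisfy the atom for \<open>w\<close>, whereas a nonempty set code
  \<open>w\<close> contains only finitely many.
\<close>

lemma arithmetical_zero: "arithmetical (\<lambda>e. e k = 0)"
proof -
  have "(\<forall>a. \<exists>b. atom b a w) \<longleftrightarrow> w = 0" for w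
  proof
    assume *: "\<forall>a. \<exists>b. atom b a w"
    show "w = 0"
    proof (rule ccontr)
      assume "w \<noteq> 0"
      then obtain b where "prod_encode (b, w) \<in> set_decode w" using * by (auto simp: atom_def)
      then show False using set_decode_less le_prod_encode_2[of w b] by fastforce
    qed
  qed (auto simp: atom_def)
  moreover have "arithmetical (\<lambda>e. \<forall>a. \<exists>b. atom b a (e k))"
    by (intro arithmetical_all arithmetical_ex arithmetical_atom)
  ultimately show ?thesis by simp
qed

lemma arithmetical_less: "arithmetical (\<lambda>e. e i < e j)"
proof -
  have "arithmetical (\<lambda>e. \<exists>z. z = 0 \<and> atom (e j) (e i) z)"
    by (intro arithmetical_ex arithmetical_conj arithmetical_zero arithmetical_atom)
  then show ?thesis by (simp add: atom_def)
qed

lemma arithmetical_eq: "arithmetical (\<lambda>e. e i = e j)"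
proof -
  have "arithmetical (\<lambda>e. \<not> e i < e j \<and> \<not> e j < e i)"
    by (intro arithmetical_conj arithmetical_not arithmetical_less)
  then show ?thesis by (simp add: not_less eq_iff conj_commute)
qed

lemma arithmetical_Suc: "arithmetical (\<lambda>e. e i = Suc (e j))"
proof -
  have "arithmetical (\<lambda>e. e j < e i \<and> \<not> (\<exists>y. e j < y \<and> y < e i))"
    by (intro arithmetical_conj arithmetical_not arithmetical_ex arithmetical_less)
  moreover have "j < i \<and> \<not> (\<exists>y. j < y \<and> y < i) \<longleftrightarrow> i = Suc j" for i j :: nat
    by (auto intro: Suc_lessI)
  ultimately show ?thesis by simp
qed

lemma arithmetical_pair_mem: "arithmetical (\<lambda>e. prod_encode (e i, e j) \<in> set_decode (e k))"
proof -
  have "arithmetical (\<lambda>e. \<not> e k = 0 \<and> atom (e i) (e j) (e k))"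
    by (intro arithmetical_conj arithmetical_not arithmetical_zero arithmetical_atom)
  moreover have "\<not> w = 0 \<and> atom x y w \<longleftrightarrow> prod_encode (x, y) \<in> set_decode w" for x y w
    by (auto simp: atom_def)
  ultimately show ?thesis by simp
qed

text \<open>The witness \<open>w\<close> codes the finite set of pairs consisting of a stage and its value.\<close>

lemma eq_rec_nat_iff:
  fixes a :: nat
  shows "v = rec_nat a h n \<longleftrightarrow> (\<exists>w.
    (\<forall>z r. z = 0 \<and> prod_encode (z, r) \<in> set_decode w \<longrightarrow> r = a) \<and>
    (\<forall>z r y. z = Suc y \<and> prod_encode (z, r) \<in> set_decode w \<longrightarrow>
      (\<exists>u. prod_encode (y, u) \<in> set_decode w \<and> r = h y u)) \<and>
    prod_encode (n, v) \<in> set_decode w)" (is "_ \<longleftrightarrow> (\<exists>w. ?base w \<and> ?step w \<and> _)")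
proof
  assume v: "v = rec_nat a h n"
  define w where "w = set_encode ((\<lambda>i. prod_encode (i, rec_nat a h i)) ` {..n})"
  have "prod_encode (z, r) \<in> set_decode w \<longleftrightarrow> z \<le> n \<and> r = rec_nat a h z" for z r
    by (auto simp: w_def)
  then show "\<exists>w. ?base w \<and> ?step w \<and> prod_encode (n, v) \<in> set_decode w"
    using v by (intro exI[of _ w]) auto
next
  assume "\<exists>w. ?base w \<and> ?step w \<and> prod_encode (n, v) \<in> set_decode w"
  then obtain w where base: "?base w" and step: "?step w" and w: "prod_encode (n, v) \<in> set_decode w"
    by blast
  have "r = rec_nat a h z" if "prod_encode (z, r) \<in> set_decode w" for z r
    using that
  proof (induction z arbitrary: r)
    case 0
    then show ?case using base by simp
  next
    case (Suc z)
    then obtain u where "prod_encode (z, u) \<in> set_decode w" "r = h z u" using step by blast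
    then show ?case using Suc.IH by simp
  qed
  then show "v = rec_nat a h n" using w .
qed

text \<open>The language has no nested terms, so the inner values are named one by one by
  existential quantifiers; \<open>is\<close> lists the variables already naming values.\<close>

lemma arithmetical_comp:
  assumes f: "\<And>rs k. length rs = m \<Longrightarrow> arithmetical (\<lambda>e. e k = f (map e rs))"
    and g: "\<And>g rs k. g \<in> set gs \<Longrightarrow> length rs = n \<Longrightarrow> arithmetical (\<lambda>e. e k = g (map e rs))"
    and "length is + length gs = m" "length rs = n"
  shows "arithmetical (\<lambda>e. e k = f (map e is @ map (\<lambda>g. g (map e rs)) gs))"
  using g assms(3,4)
proof (induction gs arbitrary: "is" rs k)
  case Nil
  then show ?case using f by simp
next
  case (Cons g gs)
  have "arithmetical (\<lambda>e. \<exists>y. y = g (map e rs) \<and> e k = f (map e is @ y # map (\<lambda>g. g (map e rs)) gs))"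
  proof (intro arithmetical_ex arithmetical_conj)
    show "arithmetical (\<lambda>e. e 0 = g (map (\<lambda>i. e (Suc i)) rs))"
      using Cons.prems(1)[of g "map Suc rs" 0] Cons.prems(3) by (simp add: comp_def)
    show "arithmetical (\<lambda>e. e (Suc k) = f (map (\<lambda>i. e (Suc i)) is @ e 0 #
        map (\<lambda>g. g (map (\<lambda>i. e (Suc i)) rs)) gs))"
      using Cons.IH[of "map Suc is @ [0]" "map Suc rs" "Suc k"] Cons.prems by (simp add: comp_def)
  qed
  then show ?case by simp
qed

section \<open>Definability of recursive and arithmetical relations\<close>

lemma arithmetical_recursive_fn:
  assumes "recursive_fn n f" "length rs = n"
  shows "arithmetical (\<lambda>e. e k = f (map e rs))"
  using assms
proof (induction n f arbitrary: rs k rule: recursive_fn.induct)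
  case (zero n)
  show ?case by (rule arithmetical_zero)
next
  case succ
  then obtain i where "rs = [i]" by (auto simp: length_Suc_conv)
  then show ?case using arithmetical_Suc by simp
next
  case (proj i n)
  then show ?case using arithmetical_eq by simp
next
  case (comp gs f n)
  show ?case using arithmetical_comp[of "length gs" f gs n "[]" rs k] comp by simp
next
  case (prim_rec n f g)
  obtain i ts where rs: "rs = i # ts" "length ts = n"
    using prim_rec.prems by (auto simp: length_Suc_conv)
  \<comment> \<open>Each quantifier shifts the free variables, hence the arbitrary renaming
    \<rho>.\<close>
  have F: "arithmetical (\<lambda>e. e k = f (map (\<lambda>i. e (\<rho> i)) ts))" for k \<rho>
    using prim_rec.IH(1)[of "map \<rho> ts" k] rs by (simp add: comp_def)
  have G: "arithmetical (\<lambda>e. e k = g (e a # e b # map (\<lambda>i. e (\<rho> i)) ts))" for k a b \<rho>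
    using prim_rec.IH(2)[of "a # b # map \<rho> ts" k] rs by (simp add: comp_def)
  show ?case
    unfolding eq_rec_nat_iff rs list.map list.sel
    by (intro arithmetical_ex arithmetical_all arithmetical_conj arithmetical_imp arithmetical_zero
        arithmetical_Suc arithmetical_pair_mem F G)
next
  case (minim n f)
  have F: "arithmetical (\<lambda>e. e k = f (e a # map (\<lambda>i. e (\<rho> i)) rs))" for k a \<rho>
    using minim.IH[of "a # map \<rho> rs" k] minim.prems by (simp add: comp_def)
  \<comment> \<open>The variable \<open>z\<close> names the constant 0, since \<open>F\<close>
    speaks only of the value of a variable.\<close>
  have "arithmetical (\<lambda>e. \<exists>z. z = 0 \<and> z = f (e k # map e rs) \<and>
      (\<forall>y. y < e k \<longrightarrow> \<not> z = f (y # map e rs)))"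
    by (intro arithmetical_ex arithmetical_all arithmetical_conj arithmetical_imp arithmetical_not
        arithmetical_zero arithmetical_less F)
  moreover have "(\<exists>z. z = 0 \<and> z = f (v # xs) \<and> (\<forall>y. y < v \<longrightarrow> \<not> z = f (y # xs))) \<longleftrightarrow>
      v = (LEAST y. f (y # xs) = 0)" if xs: "length xs = n" for v xs
  proof -
    let ?l = "LEAST y. f (y # xs) = 0"
    obtain y where "f (y # xs) = 0" using minim.hyps(2) xs by blast
    then have l: "f (?l # xs) = 0" by (rule LeastI)
    have less: "f (y # xs) \<noteq> 0" if "y < ?l" for y using not_less_Least[OF that] .
    have "f (v # xs) = 0 \<and> (\<forall>y<v. f (y # xs) \<noteq> 0) \<longleftrightarrow> v = ?l"
      using l less by (metis linorder_neqE_nat)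
    then show ?thesis by (metis (no_types))
  qed
  ultimately show ?case using minim.prems by simp
next
  case (ext n f g)
  then show ?case by simp
qed

lemma arithmetical_recursive_rel:
  assumes "recursive_rel n R" "length rs = n"
  shows "arithmetical (\<lambda>e. R (map e rs))"
proof -
  have "arithmetical (\<lambda>e. e 0 = (if R (map e (map Suc rs)) then 1 else 0))"
    using assms unfolding recursive_rel_def by (intro arithmetical_recursive_fn) simp_all
  then have F: "arithmetical (\<lambda>e. e 0 = (if R (map (\<lambda>i. e (Suc i)) rs) then 1 else 0))"
    by (simp add: comp_def)
  have "arithmetical (\<lambda>e. \<exists>y :: nat. y = (if R (map e rs) then 1 else 0) \<and> \<not> y = 0)"
    by (intro arithmetical_ex arithmetical_conj arithmetical_not arithmetical_zero F)
  then show ?thesis by (simp split: if_splits)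
qed

lemma arithmetical_rec_rel:
  assumes "rec_rel P"
  shows "arithmetical P"
proof -
  obtain n where n: "computes n (\<lambda>e. if P e then 1 else 0)"
    using assms unfolding rec_rel_def rec_fun_def ..
  then have "recursive_rel n (\<lambda>xs. P (env_of xs))"
    unfolding recursive_rel_def by (rule computes_recursive_fn)
  then have "arithmetical (\<lambda>e. P (env_of (map e [0..<n])))"
    by (rule arithmetical_recursive_rel) simp
  moreover have "P (env_of (map e [0..<n])) \<longleftrightarrow> P e" for e
    using computes_cong[OF n, of "env_of (map e [0..<n])" e] by (simp add: env_of_def split: if_splits)
  ultimately show ?thesis by simp
qed

text \<open>Each quantifier of the prefix becomes a quantifier of the formula. The levels alternate,
  so both kinds are treated in one induction.\<close>

lemma arithmetical_sigma_pi:
  "(sigma_rel i n R \<longrightarrow> length rs = n \<longrightarrow> arithmetical (\<lambda>e. R (map e rs))) \<and>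
   (pi_rel i n R \<longrightarrow> length rs = n \<longrightarrow> arithmetical (\<lambda>e. R (map e rs)))"
proof (induction i arbitrary: n R rs)
  case 0
  then show ?case by (simp add: arithmetical_recursive_rel)
next
  case (Suc i)
  have *: "arithmetical (\<lambda>e. S (e 0 # map (\<lambda>i. e (Suc i)) rs))"
    if "sigma_rel i (Suc n) S \<or> pi_rel i (Suc n) S" "length rs = n" for S
    using Suc.IH[of "Suc n" S "0 # map Suc rs"] that by (auto simp: comp_def)
  show ?case
  proof (intro conjI impI)
    assume R: "sigma_rel (Suc i) n R" and rs: "length rs = n"
    then obtain S where "pi_rel i (Suc n) S" "\<And>xs. length xs = n \<Longrightarrow> R xs \<longleftrightarrow> (\<exists>y. S (y # xs))" by auto
    then show "arithmetical (\<lambda>e. R (map e rs))"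
      using arithmetical_ex[of "\<lambda>y e. S (y # map e rs)"] * rs by simp
  next
    assume R: "pi_rel (Suc i) n R" and rs: "length rs = n"
    then obtain S where "sigma_rel i (Suc n) S" "\<And>xs. length xs = n \<Longrightarrow> R xs \<longleftrightarrow> (\<forall>y. S (y # xs))" by auto
    then show "arithmetical (\<lambda>e. R (map e rs))"
      using arithmetical_all[of "\<lambda>y e. S (y # map e rs)"] * rs by simp
  qed
qed

lemma arithmetical_sigma_set:
  assumes "sigma_set i H"
  shows "arithmetical (\<lambda>e. e k \<in> H)"
  using assms arithmetical_sigma_pi[of i 1 "\<lambda>xs. xs ! 0 \<in> H" "[k]"] by (simp add: sigma_set_def)

section \<open>Tarski's diagonal argument\<close>

theorem theorem9:
  "\<exists>C. C \<in> exactly_large_subsets UNIV \<rightarrow> {0, 1} \<and>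
       computable_coloring C \<and>
       (\<forall>H. infinite H \<and> homogeneous C H \<longrightarrow> (\<forall>i. \<not> sigma_set i H))"
proof (intro exI conjI allI impI notI)
  show "colour \<in> exactly_large_subsets UNIV \<rightarrow> {0, 1}" by (simp add: colour_def)
  show "computable_coloring colour" by (rule computable_coloring_colour)
next
  fix H i
  assume H: "infinite H \<and> homogeneous colour H" and "sigma_set i H"
  have "rec_rel (\<lambda>e. e k \<in> set_decode (e j))" for k j
    by (intro rec_rel_mem rec_fun_var)
  \<comment> \<open>The environment \<open>prod_encode (c, 0)\<close> has \<open>c\<close> as entry
    0, so \<open>c\<close> is evaluated at its own code. Entry 0 of \<open>e\<close> is reserved for
    the certificate.\<close>
  moreover have "rec_rel (\<lambda>e. decides (e 1) (prod_encode (e 1, 0)) (set_decode (e 0)))"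
    by (intro rec_rel_decides rec_fun_prod_encode rec_fun_const rec_fun_var)
  ultimately have "arithmetical (\<lambda>e. \<not> (\<exists>z. (\<forall>x. x \<in> set_decode z \<longrightarrow> x \<in> H) \<and>
      decides (e 0) (prod_encode (e 0, 0)) (set_decode z)))"
    by (intro arithmetical_not arithmetical_ex arithmetical_conj arithmetical_all arithmetical_imp
        arithmetical_sigma_set[OF \<open>sigma_set i H\<close>] arithmetical_rec_rel) simp_all
  moreover have "(\<exists>z. (\<forall>x. x \<in> set_decode z \<longrightarrow> x \<in> H) \<and> decides c p (set_decode z)) \<longleftrightarrow> sat c p" for c p
  proof -
    have "(\<exists>Z. finite Z \<and> Z \<subseteq> H \<and> decides c p Z) \<longleftrightarrow> (\<exists>z. set_decode z \<subseteq> H \<and> decides c p (set_decode z))"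
      by (metis finite_set_decode set_encode_inverse)
    then show ?thesis using sat_iff_decides[of H c p] H by (simp add: subset_iff)
  qed
  ultimately have "arithmetical (\<lambda>e. \<not> sat (e 0) (prod_encode (e 0, 0)))" by simp
  then obtain d where d: "\<And>p. sat d p \<longleftrightarrow> \<not> sat (left p) (prod_encode (left p, 0))"
    unfolding arithmetical_def entry_0 by blast
  \<comment> \<open>The liar: \<open>d\<close> defines failure of self-application and is applied to
    itself.\<close>
  from d[of "prod_encode (d, 0)"] show False by simp
qed

end
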